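(* Let $r,n$ be positive integers, let $\epsilon\in\{1,-1\}$, $h\in\{0,1,\dots,r-1\}$, and let $\chi_{\epsilon,h}$ be the corresponding one-dimensional character of $G_{r,n}$. Let $k,b$ be integers with $1\le k\le n-1$, $k\le b\le n$ and $b\equiv n\pmod 2$. Then the following identities of polynomials in $q$ hold. (i) If $n-k\equiv 0\pmod 2$, then $$\sum_{\pi\in G_{r,n}(b-k+1\,:\,b)}\chi_{\epsilon,h}(\pi)\,q^{\mathrm{fmaj}(\pi)}=\prod_{i=k+1}^{n}[ir]_{\epsilon^{i-1}\zeta^h q}.$$ (ii) If $n-k\equiv 1\pmod 2$, then $$\sum_{\pi\in G_{r,n}(b-k+1\,:\,b)}\chi_{\epsilon,h}(\pi)\,q^{\mathrm{fmaj}(\pi)}=[k+1]_{\epsilon q^r}\,[r]_{\zeta^h q}\prod_{i=k+2}^{n}[ir]_{\epsilon^{i-1}\zeta^h q}.$$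
   Context: Here $q$ is an indeterminate, $\zeta\in\mathbb{C}$ is a fixed primitive $r$th root of unity, and $[m]_x:=1+x+\cdots+x^{m-1}$ for an integer $m\ge 0$. Empty products equal $1$. $G_{r,n}=\mathbb{Z}_r\wr S_n$ is the group of colored permutations: its elements are $\pi=(\pi_1,\dots,\pi_n)=(\sigma_1^{z_1},\dots,\sigma_n^{z_n})$ with $\sigma=(\sigma_1,\dots,\sigma_n)\in S_n$ (one-line notation) and colors $z_i\in\{0,\dots,r-1\}$. Write $|\pi|=\sigma$ and $\mathrm{col}(\pi)=z_1+\cdots+z_n$ (sum of integers). A colored integer of color $0$ is written without exponent. For $\sigma\in S_n$, $\mathrm{inv}(\sigma)=\#\{i<j:\sigma_i>\sigma_j\}$. The one-dimensional character is $\chi_{\epsilon,h}(\pi)=\epsilon^{\mathrm{inv}(|\pi|)}\zeta^{h\cdot\mathrm{col}(\pi)}$. Colored integers are compared in the linear order $$1^{r-1}<\cdots<n^{r-1}<\cdots<1^1<\cdots<n^1<1<\cdots<n.$$ With this order, $\mathrm{maj}_F(\pi)=\sum_{1\le i\le n-1,\ \pi_i>\pi_{i+1}}i$ and $\mathrm{fmaj}(\pi)=r\cdot\mathrm{maj}_F(\pi)+\mathrm{col}(\pi)$. For integers $1\le a\le c\le n$, $G_{r,n}(a:c)$ is the set of $\pi\in G_{r,n}$ whose word $(\pi_1,\dots,\pi_n)$ contains $(a,a+1,\dots,c)$, all entries of color $0$, as a (not necessarily contiguous) subsequence. *)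

theory Defs
  imports
    Complex_Main
    "HOL-Computational_Algebra.Polynomial"
    "HOL-Number_Theory.Cong"
    "HOL-Combinatorics.Multiset_Permutations"
    "HOL-Library.Sublist"
begin

definition primitive_root_of_unity :: "nat \<Rightarrow> complex \<Rightarrow> bool" where
  "primitive_root_of_unity r \<zeta> \<longleftrightarrow> r > 0 \<and> \<zeta> ^ r = 1 \<and> (\<forall>m. 0 < m \<and> m < r \<longrightarrow> \<zeta> ^ m \<noteq> 1)"

definition qbracket :: "nat \<Rightarrow> 'a::comm_semiring_1 \<Rightarrow> 'a" where
  "qbracket m x = (\<Sum>i<m. x ^ i)"

text \<open>The pair \<open>(a, z)\<close> encodes the colored integer $a^z$ (value \<open>a\<close>, color \<open>z\<close>).\<close>

type_synonym colored = "nat \<times> nat"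

text \<open>Colored permutations are given in one-line notation: the list
  \<open>[(\<sigma>\<^sub>1, z\<^sub>1), \<dots>, (\<sigma>\<^sub>n, z\<^sub>n)]\<close>, where \<open>[\<sigma>\<^sub>1, \<dots>, \<sigma>\<^sub>n]\<close> is an arrangement of \<open>{1..n}\<close>.\<close>

definition colored_perms :: "nat \<Rightarrow> nat \<Rightarrow> colored list set" where
  "colored_perms r n =
     {\<pi>. map fst \<pi> \<in> permutations_of_set {1..n} \<and> (\<forall>z \<in> set (map snd \<pi>). z < r)}"

definition col :: "colored list \<Rightarrow> nat" where
  "col \<pi> = sum_list (map snd \<pi>)"

definition inv_count :: "nat list \<Rightarrow> nat" where
  "inv_count \<sigma> = card {(i, j). i < j \<and> j < length \<sigma> \<and> \<sigma> ! i > \<sigma> ! j}"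

definition char1 :: "complex \<Rightarrow> complex \<Rightarrow> nat \<Rightarrow> colored list \<Rightarrow> complex" where
  "char1 \<zeta> \<epsilon> h \<pi> = \<epsilon> ^ inv_count (map fst \<pi>) * \<zeta> ^ (h * col \<pi>)"

text \<open>The order $1^{r-1} < \cdots < n^{r-1} < \cdots < 1^1 < \cdots < n^1 < 1 < \cdots < n$:
  a larger color makes a colored integer smaller.\<close>

definition colored_less :: "colored \<Rightarrow> colored \<Rightarrow> bool" where
  "colored_less x y \<longleftrightarrow> snd x > snd y \<or> (snd x = snd y \<and> fst x < fst y)"

text \<open>Lists are indexed from 0, so the entry in position \<open>i\<close> of the word is \<open>\<pi> ! (i - 1)\<close>.\<close>

definition majF :: "colored list \<Rightarrow> nat" where
  "majF \<pi> = (\<Sum>i \<in> {i. 1 \<le> i \<and> i < length \<pi> \<and> colored_less (\<pi> ! i) (\<pi> ! (i - 1))}. i)"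

definition fmaj :: "nat \<Rightarrow> colored list \<Rightarrow> nat" where
  "fmaj r \<pi> = r * majF \<pi> + col \<pi>"

definition colored_perms_containing :: "nat \<Rightarrow> nat \<Rightarrow> nat \<Rightarrow> nat \<Rightarrow> colored list set" where
  "colored_perms_containing r n a c =
     {\<pi> \<in> colored_perms r n. subseq (map (\<lambda>v. (v, 0)) [a..<Suc c]) \<pi>}"

abbreviation q :: "complex poly" where
  "q \<equiv> monom 1 1"

end

theory Submission
  imports Defs "HOL-Combinatorics.Transposition"
begin

text \<open>
  Inserting a letter in all gaps of a word of length \<open>m\<close> over a linear order changes the major index by
  \<open>0, \<dots>, m\<close>, each exactly once. For \<open>\<epsilon> = 1\<close> one therefore starts from the word \<open>b-k+1, \<dots>, b\<close>
  and inserts the other values with all colors, one at a time; the value inserted into a word of length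
  \<open>i - 1\<close> contributes \<open>[r]\<^sub>X [i]\<close> evaluated at \<open>X\<^sup>r\<close>, i.e. \<open>[ir]\<^sub>X\<close>, for \<open>X = \<zeta>\<^sup>h q\<close>.

  For \<open>\<epsilon> = -1\<close>, let \<open>v\<close> and \<open>v + 1\<close> lie outside the run. Swapping these two values, but not the
  colors at their positions, changes the sign and keeps the flag major index, unless they are adjacent and
  have equal colors. So only words with such a domino survive, and summing over all places of the domino
  gives the factors for \<open>i\<close> and \<open>i + 1\<close> together. As \<open>n - b\<close> is even, dominoes exhaust the
  values above \<open>b\<close>, and below the run all values except, when \<open>n - k\<close> is odd, the value \<open>b - k\<close>, which is
  smaller than every letter of the run in any color and contributes \<open>[r]\<^sub>X [k+1]\<close> with \<open>-X\<^sup>r\<close>.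
\<close>

subsection \<open>The major index under insertion of a block\<close>

lemma colored_less_trans:
  "colored_less x y \<Longrightarrow> colored_less y z \<Longrightarrow> colored_less x z"
  by (auto simp: colored_less_def)

lemma colored_less_linear: "colored_less x y \<or> x = y \<or> colored_less y x"
  by (auto simp: colored_less_def prod_eq_iff)

lemma majF_conv_sum:
  "majF xs = (\<Sum>i=1..<length xs. if colored_less (xs ! i) (xs ! (i - 1)) then i else 0)"
proof -
  have "{i. 1 \<le> i \<and> i < length xs \<and> colored_less (xs ! i) (xs ! (i - 1))}
      = {i \<in> {1..<length xs}. colored_less (xs ! i) (xs ! (i - 1))}" by auto
  then show ?thesis
    unfolding majF_def by (simp only: sum.inter_filter finite_atLeastLessThan)
qed

lemma majF_Nil [simp]: "majF [] = 0"
  by (simp add: majF_conv_sum)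

lemma majF_snoc:
  "majF (xs @ [y]) =
     majF xs + (if xs \<noteq> [] \<and> colored_less y (last xs) then length xs else 0)"
proof (cases "xs = []")
  case True
  then show ?thesis by (simp add: majF_conv_sum)
next
  case False
  then have "1 \<le> length xs" by (simp add: Suc_leI)
  then have "majF (xs @ [y]) = (\<Sum>i=1..<length xs. if colored_less ((xs @ [y]) ! i) ((xs @ [y]) ! (i - 1)) then i else 0)
     + (if colored_less y ((xs @ [y]) ! (length xs - 1)) then length xs else 0)"
    by (simp add: majF_conv_sum)
  also have "(\<Sum>i=1..<length xs. if colored_less ((xs @ [y]) ! i) ((xs @ [y]) ! (i - 1)) then i else 0)
    = majF xs"
    unfolding majF_conv_sum by (rule sum.cong) (auto simp: nth_append)
  also have "(xs @ [y]) ! (length xs - 1) = last xs"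
    using False by (simp add: nth_append last_conv_nth)
  finally show ?thesis using False by simp
qed

text \<open>No descent lies inside an increasing block, so a new one can only occur at the
  junction.\<close>

lemma majF_append_sorted:
  assumes "sorted_wrt colored_less ys" "ys \<noteq> []"
  shows "majF (xs @ ys) =
    majF xs + (if xs \<noteq> [] \<and> colored_less (hd ys) (last xs) then length xs else 0)"
  using assms(2,1)
proof (induction ys rule: rev_nonempty_induct)
  case (single x)
  then show ?case by (simp add: majF_snoc)
next
  case (snoc y ys)
  have "\<not> colored_less y (last ys)"
    using snoc.prems last_in_set[OF snoc.hyps]
    by (fastforce simp: sorted_wrt_append colored_less_def)
  moreover have "majF (xs @ ys @ [y]) = majF (xs @ ys)
     + (if xs @ ys \<noteq> [] \<and> colored_less y (last (xs @ ys)) then length (xs @ ys) else 0)"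
    using majF_snoc[of "xs @ ys" y] by simp
  ultimately show ?case using snoc by (simp add: sorted_wrt_append)
qed

lemma majF_sorted: "sorted_wrt colored_less xs \<Longrightarrow> majF xs = 0"
  using majF_append_sorted[of xs "[]"] by (cases "xs = []") simp_all

text \<open>Equal lengths keep the positions of all later descents, and the letters of
  \<open>vs\<close> do not distinguish the two last letters, so a change of the major index computed
  on the prefix survives any suffix. This serves to compare the two orders of a domino.\<close>

lemma majF_replace_block:
  assumes "length B' = length B" "B \<noteq> []"
    and "\<And>y. y \<in> set vs \<Longrightarrow> colored_less y (last B') \<longleftrightarrow> colored_less y (last B)"
    and "majF (us @ B') = majF (us @ B) + c"
  shows "majF (us @ B' @ vs) = majF (us @ B @ vs) + c"
  using assms(3)
proof (induction vs rule: rev_induct)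
  case Nil
  then show ?case using assms(4) by simp
next
  case (snoc y vs)
  have "B' \<noteq> []" using assms(1,2) by auto
  have *: "majF (us @ D @ vs @ [y]) = majF (us @ D @ vs)
     + (if us @ D @ vs \<noteq> [] \<and> colored_less y (last (us @ D @ vs))
        then length us + length D + length vs else 0)" for D
    using majF_snoc[of "us @ D @ vs" y] by simp
  show ?case
    using snoc \<open>B' \<noteq> []\<close> assms(1,2) by (auto simp: * last_append)
qed

text \<open>
  The two conditions on \<open>T\<close> hold for the weight \<open>g = 1\<close> and blocks of length 1, with
  \<open>T m = [m + 1]\<close>, and for \<open>g p = 1 - Q\<^sup>p\<^sup>+\<^sup>1\<close> and blocks of length 2. In both cases every letter
  compares alike with all letters of the block, so the proof is an induction on the last letter of \<open>u\<close>.
\<close>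

lemma sum_insert_block_before_end:
  fixes Q :: "'a::comm_ring_1"
  assumes "u \<noteq> []"
    and B: "B \<noteq> []" "sorted_wrt colored_less B"
    and cmp: "\<And>y. y \<in> set u \<Longrightarrow> colored_less (hd B) y \<longleftrightarrow> \<not> colored_less y (last B)"
    and T0: "T 0 = g 0"
    and T1: "\<And>m. T (Suc m) = Q ^ length B * T m + g (Suc m)"
    and T2: "\<And>m. T (Suc m) = T m + Q ^ Suc m * g (Suc m)"
  shows "(\<Sum>p<length u. Q ^ majF (take p u @ B @ drop p u) * g p) =
    Q ^ majF u * T (length u - 1) * (if colored_less (last u) (last B) then Q ^ length B else 1)"
  using assms(1) cmp
proof (induction u rule: rev_nonempty_induct)
  case (single z)
  have "majF [z] = 0" "majF B = 0"
    using majF_snoc[of "[]" z] majF_append_sorted[OF B(2,1), of "[]"] by simp_all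
  then show ?case using T0 B(1) by (simp add: majF_snoc)
next
  case (snoc y us)
  define d where "d = length B"
  obtain m where m: "length us = Suc m" using snoc.hyps by (cases us) auto
  have hdz: "colored_less (hd B) (last us) \<longleftrightarrow> \<not> colored_less (last us) (last B)"
    using snoc.prems snoc.hyps by simp
  \<comment> \<open>For \<open>p < length us\<close> the letter in front of \<open>y\<close> is
    still \<open>last us\<close>; a descent there has moved to position
    \<open>Suc m + d\<close>.\<close>
  have "Q ^ majF (take p (us @ [y]) @ B @ drop p (us @ [y]))
      = Q ^ majF (take p us @ B @ drop p us) * (if colored_less y (last us) then Q ^ (Suc m + d) else 1)"
    if "p < length us" for p
  proof -
    have "majF ((take p us @ B @ drop p us) @ [y]) = majF (take p us @ B @ drop p us)
       + (if colored_less y (last us) then Suc m + d else 0)"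
      using that B(1) m d_def by (simp only: majF_snoc) (simp add: last_append)
    then show ?thesis using that by (simp add: power_add)
  qed
  then have "(\<Sum>p<length us. Q ^ majF (take p (us @ [y]) @ B @ drop p (us @ [y])) * g p)
     = (\<Sum>p<length us. Q ^ majF (take p us @ B @ drop p us) * g p)
         * (if colored_less y (last us) then Q ^ (Suc m + d) else 1)"
    unfolding sum_distrib_right by (intro sum.cong) (auto simp: mult_ac)
  also have "(\<Sum>p<length us. Q ^ majF (take p us @ B @ drop p us) * g p)
     = Q ^ majF us * T m * (if colored_less (last us) (last B) then Q ^ d else 1)"
    using snoc.IH snoc.prems m d_def by simp
  finally have s1: "(\<Sum>p<length us. Q ^ majF (take p (us @ [y]) @ B @ drop p (us @ [y])) * g p)
     = Q ^ majF us * T m * (if colored_less (last us) (last B) then Q ^ d else 1)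
         * (if colored_less y (last us) then Q ^ (Suc m + d) else 1)" .
  \<comment> \<open>The remaining gap, between \<open>us\<close> and \<open>y\<close>: one possible
    descent on each side of the block, the left one governed by \<open>hdz\<close>.\<close>
  have "majF ((us @ B) @ [y]) = majF us + (if colored_less (last us) (last B) then 0 else Suc m)
      + (if colored_less y (last B) then Suc m + d else 0)"
    using B(1) snoc.hyps m d_def hdz majF_append_sorted[OF B(2,1), of us]
    by (simp only: majF_snoc) (simp add: last_append)
  then have s2: "Q ^ majF (us @ B @ [y]) = Q ^ majF us
      * (if colored_less (last us) (last B) then 1 else Q ^ Suc m)
      * (if colored_less y (last B) then Q ^ (Suc m + d) else 1)"
    by (simp add: power_add)
  have s3: "Q ^ majF (us @ [y]) = Q ^ majF us * (if colored_less y (last us) then Q ^ Suc m else 1)"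
    using m snoc.hyps by (simp add: majF_snoc power_add)
  \<comment> \<open>Transitivity and linearity exclude two of the eight patterns of comparisons
    among \<open>y\<close>, \<open>last us\<close> and \<open>last B\<close>. Of the other six,
    three reduce to \<open>T1\<close> and three to \<open>T2\<close>.\<close>
  have o1: "colored_less y (last us) \<Longrightarrow> colored_less (last us) (last B) \<Longrightarrow> colored_less y (last B)"
    by (rule colored_less_trans)
  have o2: "\<not> colored_less y (last us) \<Longrightarrow> colored_less y (last B) \<Longrightarrow> colored_less (last us) (last B)"
    using colored_less_linear[of y "last us"] colored_less_trans by metis
  have "(\<Sum>p<length (us @ [y]). Q ^ majF (take p (us @ [y]) @ B @ drop p (us @ [y])) * g p)
    = Q ^ majF us * T m * (if colored_less (last us) (last B) then Q ^ d else 1)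
         * (if colored_less y (last us) then Q ^ (Suc m + d) else 1)
      + Q ^ majF us * (if colored_less (last us) (last B) then 1 else Q ^ Suc m)
      * (if colored_less y (last B) then Q ^ (Suc m + d) else 1) * g (Suc m)"
    using s1 s2 m by simp
  also have "\<dots> = Q ^ majF (us @ [y]) * T (Suc m)
      * (if colored_less y (last B) then Q ^ d else 1)"
  proof (cases "colored_less y (last us)")
    case y: True
    show ?thesis
    proof (cases "colored_less (last us) (last B)")
      case True
      then show ?thesis unfolding s3 using y o1
        by (simp add: d_def T1 power_add algebra_simps)
    next
      case z: False
      show ?thesis
      proof (cases "colored_less y (last B)")
        case True
        then show ?thesis unfolding s3 using y z
          by (simp add: d_def T2 power_add algebra_simps)
      next
        case False
        then show ?thesis unfolding s3 using y z
          by (simp add: d_def T1 power_add algebra_simps)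
      qed
    qed
  next
    case y: False
    show ?thesis
    proof (cases "colored_less (last us) (last B)")
      case z: True
      show ?thesis
      proof (cases "colored_less y (last B)")
        case True
        then show ?thesis unfolding s3 using y z
          by (simp add: d_def T2 power_add algebra_simps)
      next
        case False
        then show ?thesis unfolding s3 using y z
          by (simp add: d_def T1 power_add algebra_simps)
      qed
    next
      case False
      then have "\<not> colored_less y (last B)" using y o2 by blast
      then show ?thesis unfolding s3 using y False
        by (simp add: d_def T2 power_add algebra_simps)
    qed
  qed
  finally show ?case using m d_def by simp
qed

text \<open>The gap after the last letter completes \<open>sum_insert_block_before_end\<close>:
  comparing \<open>last u\<close> with \<open>last B\<close> decides which of the recursions
  \<open>T1\<close>, \<open>T2\<close> applies, and both lead to
  \<open>T (length u)\<close>.\<close>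

lemma sum_insert_block:
  fixes Q :: "'a::comm_ring_1"
  assumes B: "B \<noteq> []" "sorted_wrt colored_less B"
    and cmp: "\<And>y. y \<in> set u \<Longrightarrow> colored_less (hd B) y \<longleftrightarrow> \<not> colored_less y (last B)"
    and T0: "T 0 = g 0"
    and T1: "\<And>m. T (Suc m) = Q ^ length B * T m + g (Suc m)"
    and T2: "\<And>m. T (Suc m) = T m + Q ^ Suc m * g (Suc m)"
  shows "(\<Sum>p\<le>length u. Q ^ majF (take p u @ B @ drop p u) * g p) = Q ^ majF u * T (length u)"
proof (cases "u = []")
  case True
  then show ?thesis using majF_append_sorted[OF B(2,1), of "[]"] T0 by simp
next
  case False
  then obtain m where m: "length u = Suc m" by (cases u) auto
  have "(\<Sum>p\<le>length u. Q ^ majF (take p u @ B @ drop p u) * g p)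
    = (\<Sum>p<length u. Q ^ majF (take p u @ B @ drop p u) * g p) + Q ^ majF (u @ B) * g (length u)"
    using sum.lessThan_Suc[of "\<lambda>p. Q ^ majF (take p u @ B @ drop p u) * g p" "length u"]
    by (simp add: lessThan_Suc_atMost)
  also have "Q ^ majF (u @ B) = Q ^ majF u * (if colored_less (last u) (last B) then 1 else Q ^ Suc m)"
    using majF_append_sorted[OF B(2,1), of u] False m cmp by (simp add: power_add)
  also have "(\<Sum>p<length u. Q ^ majF (take p u @ B @ drop p u) * g p)
    = Q ^ majF u * T m * (if colored_less (last u) (last B) then Q ^ length B else 1)"
    using sum_insert_block_before_end[OF False B cmp T0 T1 T2] m by simp
  finally have "(\<Sum>p\<le>length u. Q ^ majF (take p u @ B @ drop p u) * g p) =
     Q ^ majF u * (if colored_less (last u) (last B)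
        then Q ^ length B * T m + g (Suc m) else T m + Q ^ Suc m * g (Suc m))"
    using m by (simp add: algebra_simps)
  then show ?thesis using T1[of m] T2[of m] m by simp
qed

subsection \<open>Inversions\<close>

text \<open>The recursive form of \<open>inv_count\<close>, which splits along \<open>@\<close> and
  so suits words cut at an inserted letter.\<close>

fun invs :: "nat list \<Rightarrow> nat" where
  "invs [] = 0"
| "invs (x # xs) = length (filter (\<lambda>y. y < x) xs) + invs xs"

lemma inv_count_eq_invs: "inv_count xs = invs xs"
proof (induction xs)
  case Nil
  then show ?case by (simp add: inv_count_def)
next
  case (Cons x xs)
  let ?I = "\<lambda>ys. {(i, j). i < j \<and> j < length ys \<and> ys ! i > (ys ! j :: nat)}"
  let ?J = "{j. j < length xs \<and> xs ! j < x}"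
  have eq: "?I (x # xs) = (\<lambda>j. (0, Suc j)) ` ?J \<union> (\<lambda>(i, j). (Suc i, Suc j)) ` ?I xs"
  proof (intro set_eqI iffI)
    fix t assume "t \<in> ?I (x # xs)"
    then show "t \<in> (\<lambda>j. (0, Suc j)) ` ?J \<union> (\<lambda>(i, j). (Suc i, Suc j)) ` ?I xs"
      by (cases t; cases "fst t"; cases "snd t") (auto simp: image_iff)
  qed auto
  have "?I xs \<subseteq> {..<length xs} \<times> {..<length xs}" by auto
  then have "finite (?I xs)" by (rule finite_subset) simp
  then have "card (?I (x # xs)) = card ((\<lambda>j. (0::nat, Suc j)) ` ?J) + card ((\<lambda>(i, j). (Suc i, Suc j)) ` ?I xs)"
    unfolding eq by (intro card_Un_disjoint) auto
  also have "\<dots> = card ?J + card (?I xs)"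
    by (intro arg_cong2[where f = "(+)"] card_image inj_onI) auto
  finally show ?case
    using Cons by (simp add: inv_count_def length_filter_conv_card)
qed

lemma invs_append:
  "invs (xs @ ys) = invs xs + invs ys + (\<Sum>x\<leftarrow>xs. length (filter (\<lambda>y. y < x) ys))"
  by (induction xs) auto

lemma invs_sorted: "sorted xs \<Longrightarrow> invs xs = 0"
  by (induction xs) (auto simp: filter_empty_conv)

text \<open>No value lies strictly between \<open>v\<close> and \<open>Suc v\<close>, so every other
  entry compares alike with both; only the pair itself changes.\<close>

lemma invs_swap_consecutive:
  assumes "v \<notin> set (xs @ ys @ zs)" "Suc v \<notin> set (xs @ ys @ zs)"
  shows "invs (xs @ Suc v # ys @ v # zs) = Suc (invs (xs @ v # ys @ Suc v # zs))"
proof -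
  have f: "filter (\<lambda>y. y < Suc v) l = filter (\<lambda>y. y < v) l" if "v \<notin> set l" for l
    using that by (intro filter_cong) (auto simp: less_Suc_eq)
  have g: "(\<Sum>x\<leftarrow>l. length (filter (\<lambda>y. y < x) (Suc v # t @ v # w))) =
      (\<Sum>x\<leftarrow>l. length (filter (\<lambda>y. y < x) (v # t @ Suc v # w)))"
    if "v \<notin> set l" "Suc v \<notin> set l" for l t w
    using that by (intro arg_cong[where f = sum_list] map_cong refl) auto
  have h: "(\<Sum>x\<leftarrow>l. length (filter (\<lambda>y. y < x) (v # t))) =
      (\<Sum>x\<leftarrow>l. length (filter (\<lambda>y. y < x) (Suc v # t)))"
    if "v \<notin> set l" "Suc v \<notin> set l" for l t
    using that by (intro arg_cong[where f = sum_list] map_cong refl) (auto, metis Suc_lessI)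
  show ?thesis
    using assms g[of xs ys zs] h[of ys zs]
    by (simp add: invs_append f)
qed

text \<open>Any other entry is inverted with both inserted values or with neither, and these two
  stand in increasing order.\<close>

lemma even_invs_insert_consecutive:
  assumes "v \<notin> set (xs @ ys)" "Suc v \<notin> set (xs @ ys)"
  shows "even (invs (xs @ v # Suc v # ys)) \<longleftrightarrow> even (invs (xs @ ys))"
proof -
  have f: "filter (\<lambda>y. y < Suc v) ys = filter (\<lambda>y. y < v) ys"
    using assms by (intro filter_cong) (auto simp: less_Suc_eq)
  have "even (\<Sum>x\<leftarrow>l. length (filter (\<lambda>y. y < x) (v # Suc v # ys)))
      \<longleftrightarrow> even (\<Sum>x\<leftarrow>l. length (filter (\<lambda>y. y < x) ys))"
    if "v \<notin> set l" "Suc v \<notin> set l" for l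
    using that
  proof (induction l)
    case (Cons x l)
    then have "v < x \<longleftrightarrow> Suc v < x" by (auto simp: Suc_le_eq le_less)
    then show ?case using Cons by auto
  qed simp
  from this[of xs] have "even (\<Sum>x\<leftarrow>xs. length (filter (\<lambda>y. y < x) (v # Suc v # ys)))
      \<longleftrightarrow> even (\<Sum>x\<leftarrow>xs. length (filter (\<lambda>y. y < x) ys))" using assms by simp
  moreover have "invs (v # Suc v # ys) = 2 * length (filter (\<lambda>y. y < v) ys) + invs ys"
    by (simp add: f)
  ultimately show ?thesis
    by (simp add: invs_append del: filter.simps invs.simps)
qed

text \<open>The minimal letter is inverted exactly with the \<open>p\<close> letters to its left,
  and \<open>l\<close> has no inversions of its own.\<close>

lemma invs_insert_min:
  assumes "sorted l" "\<And>x. x \<in> set l \<Longrightarrow> w < x" "p \<le> length l"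
  shows "invs (take p l @ w # drop p l) = p"
proof -
  have "length (filter (\<lambda>y. y < x) (w # drop p l)) = 1" if "x \<in> set (take p l)" for x
  proof -
    have "\<forall>y \<in> set (drop p l). x \<le> y"
      using assms(1) that sorted_append[of "take p l" "drop p l"] by simp
    moreover have "w < x" using that assms(2) by (meson in_set_takeD)
    ultimately show ?thesis by (auto simp: filter_empty_conv)
  qed
  then have "(\<Sum>x\<leftarrow>take p l. length (filter (\<lambda>y. y < x) (w # drop p l))) = (\<Sum>x\<leftarrow>take p l. 1)"
    by (intro arg_cong[where f = sum_list] map_cong) auto
  moreover have "sorted (w # drop p l)"
    using assms by (auto simp: sorted_wrt_drop dest: in_set_dropD less_imp_le)
  ultimately show ?thesis
    using assms(1,3) invs_sorted[of "take p l"] invs_sorted[of "w # drop p l"]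
    by (simp add: invs_append sorted_wrt_take sum_list_triv)
qed

subsection \<open>Words containing a fixed subword\<close>

text \<open>The value set \<open>V\<close> is arbitrary so that values can be added or removed in an
  induction. Stating the subword condition by \<open>filter\<close> makes it insensitive to letters
  with values outside \<open>C\<close>.\<close>

definition words :: "nat \<Rightarrow> colored list \<Rightarrow> nat set \<Rightarrow> colored list set" where
  "words r C V = {\<pi>. distinct (map fst \<pi>) \<and> fst ` set \<pi> = V \<and> (\<forall>x \<in> set \<pi>. snd x < r)
     \<and> filter (\<lambda>x. fst x \<in> fst ` set C) \<pi> = C}"

lemma finite_words:
  assumes "finite V"
  shows "finite (words r C V)"
proof (rule finite_subset)
  show "words r C V \<subseteq> {\<pi>. set \<pi> \<subseteq> V \<times> {..<r} \<and> distinct \<pi>}"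
    by (auto simp: words_def distinct_map intro: rev_image_eqI)
  show "finite {\<pi>. set \<pi> \<subseteq> V \<times> {..<r} \<and> distinct \<pi>}"
    using assms by (intro finite_subset_distinct) simp
qed

lemma length_words: "\<pi> \<in> words r C V \<Longrightarrow> length \<pi> = card V"
  by (auto simp: words_def) (metis distinct_card length_map list.set_map)

lemma words_self:
  assumes "distinct (map fst C)" "\<And>x. x \<in> set C \<Longrightarrow> snd x < r"
  shows "words r C (fst ` set C) = {C}"
proof -
  have "\<pi> = C" if "fst ` set \<pi> = fst ` set C" "filter (\<lambda>x. fst x \<in> fst ` set C) \<pi> = C" for \<pi>
    using that by (metis filter_True imageI)
  moreover have "filter (\<lambda>x. fst x \<in> fst ` set C) C = C" by (simp add: filter_id_conv)
  ultimately show ?thesis using assms by (auto simp: words_def)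
qed

text \<open>Deleting \<open>B\<close> and recording the gap \<open>p\<close> is a bijection. As
  \<open>B\<close> shares no value with \<open>C\<close>, the condition on \<open>C\<close> is
  unaffected.\<close>

lemma sum_words_containing_block:
  assumes B: "B \<noteq> []" "distinct (map fst B)" "fst ` set B \<subseteq> V"
      "fst ` set B \<inter> fst ` set C = {}" "\<And>x. x \<in> set B \<Longrightarrow> snd x < r"
    and fin: "finite V"
  shows "sum f {\<pi> \<in> words r C V. \<exists>us vs. \<pi> = us @ B @ vs} =
    (\<Sum>u \<in> words r C (V - fst ` set B). \<Sum>p\<le>length u. f (take p u @ B @ drop p u))"
proof -
  let ?S = "SIGMA u : words r C (V - fst ` set B). {..length u}"
  let ?ins = "\<lambda>(u, p). take p u @ B @ drop p u"
  have fB: "filter (\<lambda>x. fst x \<in> fst ` set C) B = []"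
    using B(4) by (auto simp: filter_empty_conv)
  have mem: "us @ B @ vs \<in> words r C V \<longleftrightarrow> us @ vs \<in> words r C (V - fst ` set B)" for us vs
    using B fB unfolding words_def by auto
  have "bij_betw ?ins ?S {\<pi> \<in> words r C V. \<exists>us vs. \<pi> = us @ B @ vs}"
  proof (intro bij_betw_imageI inj_onI set_eqI iffI)
    fix s t assume "s \<in> ?S" "t \<in> ?S" and eq: "?ins s = ?ins t"
    then obtain us p us' p' where st: "s = (us, p)" "t = (us', p')" "p \<le> length us" "p' \<le> length us'"
        "us \<in> words r C (V - fst ` set B)" "us' \<in> words r C (V - fst ` set B)" by auto
    have notin: "hd B \<notin> set l" if "l \<in> words r C (V - fst ` set B)" for l
      using that B(1) unfolding words_def by (cases B) auto
    then have "hd B \<notin> set (take p us)" "hd B \<notin> set (take p' us')"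
      using st(5,6) by (meson in_set_takeD)+
    \<comment> \<open>\<open>hd B\<close> occurs once in either word, so its position recovers
      \<open>p\<close> and both halves of \<open>us\<close>.\<close>
    moreover have "B @ l = hd B # tl B @ l" for l using B(1) by (cases B) auto
    then have "take p us @ hd B # tl B @ drop p us = take p' us' @ hd B # tl B @ drop p' us'"
      using eq st(1,2) by (metis case_prod_conv)
    moreover have "hd B \<notin> set (tl B)" using B(1,2) by (cases B) force+
    then have "hd B \<notin> set (tl B @ drop p us)"
      using notin[OF st(5)] by (auto dest: in_set_dropD)
    ultimately have "take p us = take p' us' \<and> tl B @ drop p us = tl B @ drop p' us'"
      by (metis append_Cons_eq_iff)
    then show "s = t"
      using st by (metis append_take_drop_id length_take min.absorb2 same_append_eq)
  next
    fix \<pi> assume "\<pi> \<in> ?ins ` ?S"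
    then show "\<pi> \<in> {\<pi> \<in> words r C V. \<exists>us vs. \<pi> = us @ B @ vs}"
      using mem by fastforce
  next
    fix \<pi> assume "\<pi> \<in> {\<pi> \<in> words r C V. \<exists>us vs. \<pi> = us @ B @ vs}"
    then obtain us vs where "\<pi> = us @ B @ vs" "us @ vs \<in> words r C (V - fst ` set B)"
      using mem by blast
    then show "\<pi> \<in> ?ins ` ?S"
      by (intro image_eqI[of _ _ "(us @ vs, length us)"]) auto
  qed
  then have "sum f {\<pi> \<in> words r C V. \<exists>us vs. \<pi> = us @ B @ vs} = sum (f \<circ> ?ins) ?S"
    by (simp add: sum.reindex_bij_betw comp_def)
  also have "\<dots> = (\<Sum>u \<in> words r C (V - fst ` set B). \<Sum>p\<le>length u. f (take p u @ B @ drop p u))"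
    using finite_words[of "V - fst ` set B" r C] fin by (subst sum.Sigma) (auto simp: case_prod_unfold)
  finally show ?thesis .
qed

text \<open>Words are classified by the color of \<open>v\<close>; the classes are disjoint because
  a word has only one letter of value \<open>v\<close>.\<close>

lemma sum_words_insert_letter:
  fixes f :: "colored list \<Rightarrow> 'a::comm_monoid_add"
  assumes "finite V" "v \<in> V" "v \<notin> fst ` set C"
  shows "sum f (words r C V) =
    (\<Sum>z<r. \<Sum>u \<in> words r C (V - {v}). \<Sum>p\<le>length u. f (take p u @ (v, z) # drop p u))"
proof -
  let ?P = "\<lambda>z. {\<pi> \<in> words r C V. \<exists>us vs. \<pi> = us @ [(v, z)] @ vs}"
  have "words r C V \<subseteq> (\<Union>z<r. ?P z)"
  proof
    fix \<pi> assume \<pi>: "\<pi> \<in> words r C V"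
    then obtain z where z: "(v, z) \<in> set \<pi>" using assms(2) by (auto simp: words_def)
    then obtain us vs where "\<pi> = us @ [(v, z)] @ vs" by (auto dest: split_list)
    moreover have "z < r" using \<pi> z by (auto simp: words_def)
    ultimately show "\<pi> \<in> (\<Union>z<r. ?P z)" using \<pi> by blast
  qed
  then have eq: "words r C V = (\<Union>z<r. ?P z)" by blast
  have disj: "?P z \<inter> ?P z' = {}" if "z \<noteq> z'" for z z'
  proof -
    have False if "\<pi> \<in> ?P z" "\<pi> \<in> ?P z'" for \<pi>
    proof -
      have "(v, y) \<in> set \<pi>" if "\<pi> \<in> ?P y" for y using that by auto
      then have "(v, z) \<in> set \<pi>" "(v, z') \<in> set \<pi>" using that by blast+
      moreover have "distinct (map fst \<pi>)" using that by (auto simp: words_def)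
      ultimately show False using \<open>z \<noteq> z'\<close> by (metis eq_key_imp_eq_value)
    qed
    then show ?thesis by blast
  qed
  have "sum f (words r C V) = (\<Sum>z<r. sum f (?P z))"
    by (subst eq, rule sum.UNION_disjoint) (use finite_words[OF assms(1)] disj in auto)
  also have "\<dots> = (\<Sum>z<r. \<Sum>u \<in> words r C (V - {v}). \<Sum>p\<le>length u. f (take p u @ (v, z) # drop p u))"
    using assms by (intro sum.cong[OF refl, of "{..<r}"], subst sum_words_containing_block) auto
  finally show ?thesis .
qed

text \<open>A general form of the summand: \<open>e\<close> records the sign, \<open>X\<close> the
  colors and \<open>Q\<close> the major index. In the theorem, \<open>e\<close> is a constant
  polynomial, X is zeta^h q, and Q is q^r, which equals X^r.\<close>

definition weight :: "'a::comm_ring_1 \<Rightarrow> 'a \<Rightarrow> 'a \<Rightarrow> colored list \<Rightarrow> 'a" where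
  "weight e X Q \<pi> = e ^ invs (map fst \<pi>) * X ^ col \<pi> * Q ^ majF \<pi>"

lemma col_append: "col (xs @ ys) = col xs + col ys"
  by (simp add: col_def)

lemma sum_weight_insert_letter:
  fixes X Q :: "'a::comm_ring_1"
  assumes "finite V" "v \<in> V" "v \<notin> fst ` set C"
  shows "sum (weight 1 X Q) (words r C V) =
    sum (weight 1 X Q) (words r C (V - {v})) * (qbracket r X * qbracket (card V) Q)"
proof -
  have ins: "(\<Sum>p\<le>length u. weight 1 X Q (take p u @ (v, z) # drop p u))
      = weight 1 X Q u * X ^ z * qbracket (card V) Q" if u: "u \<in> words r C (V - {v})" for u z
  proof -
    have "(\<Sum>p\<le>length u. Q ^ majF (take p u @ [(v, z)] @ drop p u) * (\<lambda>_. 1) p)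
      = Q ^ majF u * qbracket (Suc (length u)) Q"
    proof (rule sum_insert_block)
      fix y assume "y \<in> set u"
      then have "fst y \<noteq> v" using u by (auto simp: words_def)
      then show "colored_less (hd [(v, z)]) y \<longleftrightarrow> \<not> colored_less y (last [(v, z)])"
        by (auto simp: colored_less_def)
    next
      \<comment> \<open>Splitting off exponent 0 gives \<open>T1\<close>; splitting off the top
        exponent gives \<open>T2\<close>, which is left to the closing simplification.\<close>
      fix m show "qbracket (Suc (Suc m)) Q = Q ^ length [(v, z)] * qbracket (Suc m) Q + 1"
        unfolding qbracket_def by (subst sum.lessThan_Suc_shift) (simp add: sum_distrib_left del: sum.lessThan_Suc)
    qed (simp_all add: qbracket_def)
    moreover have "col (take p u @ (v, z) # drop p u) = z + col u" for p
      using col_append[of "take p u" "drop p u"] by (simp add: col_def)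
    moreover have "Suc (length u) = card V"
      using length_words[OF u] assms(1,2) by (metis card_Suc_Diff1)
    ultimately show ?thesis
      by (simp add: weight_def power_add sum_distrib_left[symmetric] mult_ac)
  qed
  define W where "W = sum (weight 1 X Q) (words r C (V - {v}))"
  have "sum (weight 1 X Q) (words r C V) = (\<Sum>z<r. W * (X ^ z * qbracket (card V) Q))"
    unfolding sum_words_insert_letter[OF assms]
    by (simp add: ins W_def sum_distrib_right mult.assoc)
  also have "\<dots> = W * (qbracket r X * qbracket (card V) Q)"
    by (simp add: qbracket_def[of r X] sum_distrib_left sum_distrib_right)
  finally show ?thesis by (simp add: W_def)
qed

subsection \<open>Products of brackets\<close>

text \<open>The factor contributed by two adjacent letters \<open>v\<close>, \<open>v + 1\<close> of equal color inserted into a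
  word of length \<open>m\<close>; swapping them when they start at position \<open>p + 1\<close> costs a sign and \<open>Q\<^sup>p\<^sup>+\<^sup>1\<close>.\<close>

definition pair_factor :: "'a::comm_ring_1 \<Rightarrow> nat \<Rightarrow> 'a" where
  "pair_factor Q m = (\<Sum>p\<le>m. Q ^ p * (1 - Q ^ Suc p))"

text \<open>This is \<open>T1\<close> of \<open>sum_insert_block\<close> for blocks of length 2;
  \<open>T2\<close> is the summation itself.\<close>

lemma pair_factor_Suc': "pair_factor Q (Suc m) = Q\<^sup>2 * pair_factor Q m + (1 - Q ^ Suc (Suc m))"
  by (induction m) (simp_all add: pair_factor_def algebra_simps power2_eq_square)

text \<open>A division-free closed form: \<open>pair_factor Q m\<close> is \<open>1 - Q\<close>
  times the Gaussian binomial coefficient of m + 2 over 2.\<close>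

lemma pair_factor_mult: "(1 - Q\<^sup>2) * pair_factor Q m = (1 - Q ^ Suc m) * (1 - Q ^ Suc (Suc m))"
  by (induction m) (simp_all add: pair_factor_def algebra_simps power2_eq_square)

lemma qbracket_mult: "(1 - x) * qbracket m x = 1 - (x::'a::comm_ring_1) ^ m"
  by (simp add: qbracket_def one_diff_power_eq)

text \<open>Each exponent below \<open>m * r\<close> is uniquely \<open>i * r + j\<close> with
  \<open>j < r\<close>; the induction adds one block of \<open>r\<close> exponents at a
  time.\<close>

lemma qbracket_mult_power: "qbracket r X * qbracket m (X ^ r) = qbracket (m * r) (X :: 'a::comm_ring_1)"
proof (induction m)
  case (Suc m)
  have "qbracket (m * r + j) X = qbracket (m * r) X + X ^ (m * r) * qbracket j X" for j
    by (induction j) (simp_all add: qbracket_def power_add algebra_simps)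
  from this[of r] have "qbracket (Suc m * r) X = qbracket (m * r) X + X ^ (m * r) * qbracket r X"
    by (simp add: add.commute)
  moreover have "qbracket (Suc m) (X ^ r) = qbracket m (X ^ r) + X ^ (m * r)"
    by (simp add: qbracket_def power_mult[symmetric] mult.commute)
  ultimately show ?case using Suc by (simp add: algebra_simps)
qed (simp add: qbracket_def)

text \<open>Multiplying by 1 - X^2 turns every bracket into a difference of powers; in a domain this
  nonzero factor can be cancelled.\<close>

lemma qbracket_pair_factor:
  fixes X :: "'a::idom"
  assumes "X\<^sup>2 \<noteq> 1"
  shows "qbracket r (X\<^sup>2) * pair_factor (X ^ r) m =
    qbracket (Suc m * r) ((-1) ^ m * X) * qbracket (Suc (Suc m) * r) ((-1) ^ Suc m * X)"
proof -
  let ?R = "qbracket (Suc m * r) ((-1) ^ m * X) * qbracket (Suc (Suc m) * r) ((-1) ^ Suc m * X)"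
  have p: "(X ^ r) ^ j = X ^ (j * r)" for j by (simp add: power_mult[symmetric] mult.commute)
  have "(1 - X\<^sup>2) * (qbracket r (X\<^sup>2) * pair_factor (X ^ r) m) = (1 - (X\<^sup>2) ^ r) * pair_factor (X ^ r) m"
    by (simp add: qbracket_mult mult.assoc[symmetric])
  also have "(X\<^sup>2) ^ r = (X ^ r)\<^sup>2" by (simp add: power_mult[symmetric] mult.commute)
  also have "(1 - (X ^ r)\<^sup>2) * pair_factor (X ^ r) m = (1 - X ^ (Suc m * r)) * (1 - X ^ (Suc (Suc m) * r))"
    by (subst pair_factor_mult) (simp only: p)
  \<comment> \<open>The sign is -1 only for odd \<open>m\<close>, when the exponent
    \<open>Suc m * r\<close> is even; likewise for the second factor.\<close>
  also have "X ^ (Suc m * r) = ((-1) ^ m * X) ^ (Suc m * r)"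
    by (cases "even m") (simp_all add: power_minus_even)
  also have "X ^ (Suc (Suc m) * r) = ((-1) ^ Suc m * X) ^ (Suc (Suc m) * r)"
    by (cases "even m") (simp_all add: power_minus_even)
  also have "(1 - ((-1) ^ m * X) ^ (Suc m * r)) * (1 - ((-1) ^ Suc m * X) ^ (Suc (Suc m) * r))
    = (1 - (-1) ^ m * X) * (1 - (-1) ^ Suc m * X) * ?R"
    unfolding qbracket_mult[symmetric] by (simp only: mult_ac)
  \<comment> \<open>Exactly one of the two signs is -1, whatever the parity of
    \<open>m\<close>.\<close>
  also have "(1 - (-1) ^ m * X) * (1 - (-1) ^ Suc m * X) = 1 - X\<^sup>2"
    by (cases "even m") (simp_all add: algebra_simps power2_eq_square)
  finally show ?thesis using assms by simp
qed

subsection \<open>Cancellation by swapping consecutive values\<close>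

definition swap_values :: "nat \<Rightarrow> colored list \<Rightarrow> colored list" where
  "swap_values v = map (\<lambda>(a, z). (transpose v (Suc v) a, z))"

definition has_domino :: "nat \<Rightarrow> colored list \<Rightarrow> bool" where
  "has_domino v \<pi> \<longleftrightarrow> (\<exists>us z vs. \<pi> = us @ [(v, z), (Suc v, z)] @ vs \<or> \<pi> = us @ [(Suc v, z), (v, z)] @ vs)"

lemma swap_values_swap_values [simp]: "swap_values v (swap_values v \<pi>) = \<pi>"
  by (simp add: swap_values_def case_prod_unfold comp_def)

lemma has_domino_swap_values: "has_domino v (swap_values v \<pi>) \<longleftrightarrow> has_domino v \<pi>"
proof -
  have "has_domino v (swap_values v \<pi>)" if "has_domino v \<pi>" for \<pi>
  proof -
    have "swap_values v (us @ [(v, z), (Suc v, z)] @ vs)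
        = swap_values v us @ [(Suc v, z), (v, z)] @ swap_values v vs"
      "swap_values v (us @ [(Suc v, z), (v, z)] @ vs)
        = swap_values v us @ [(v, z), (Suc v, z)] @ swap_values v vs" for us z vs
      by (simp_all add: swap_values_def)
    then show ?thesis using that unfolding has_domino_def by metis
  qed
  from this this[of "swap_values v \<pi>"] show ?thesis by auto
qed

lemma map_fst_swap_values: "map fst (swap_values v \<pi>) = map (transpose v (Suc v)) (map fst \<pi>)"
  by (simp add: swap_values_def case_prod_unfold comp_def)

lemma swap_values_words:
  assumes "v \<in> V" "Suc v \<in> V" "v \<notin> fst ` set C" "Suc v \<notin> fst ` set C" "\<pi> \<in> words r C V"
  shows "swap_values v \<pi> \<in> words r C V"
proof -
  let ?t = "transpose v (Suc v)"
  have "distinct (map fst (swap_values v \<pi>))"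
    using assms(5) inj_on_subset[OF inj_transpose subset_UNIV]
    unfolding map_fst_swap_values by (subst distinct_map) (auto simp: words_def)
  moreover have "fst ` set (swap_values v \<pi>) = V"
  proof -
    have "fst ` set (swap_values v \<pi>) = ?t ` fst ` set \<pi>"
      by (simp add: swap_values_def image_image case_prod_unfold)
    also have "\<dots> = V"
      using assms by (simp add: words_def transpose_image_eq)
    finally show ?thesis .
  qed
  moreover have "\<forall>x \<in> set (swap_values v \<pi>). snd x < r"
    using assms(5) by (auto simp: swap_values_def words_def)
  \<comment> \<open>\<open>C\<close> uses neither value, so the filter selects the same positions,
    and the letters there are unchanged.\<close>
  moreover have "filter (\<lambda>x. fst x \<in> fst ` set C) (swap_values v l) = filter (\<lambda>x. fst x \<in> fst ` set C) l" for l
  proof (induction l)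
    case (Cons x l)
    have "transpose v (Suc v) (fst x) \<in> fst ` set C \<longleftrightarrow> fst x \<in> fst ` set C"
      and "fst x \<in> fst ` set C \<Longrightarrow> transpose v (Suc v) (fst x) = fst x"
      using assms(3,4) by (metis transpose_def)+
    then show ?case using Cons by (cases x) (auto simp: swap_values_def)
  qed (simp add: swap_values_def)
  ultimately show ?thesis using assms(5) by (simp add: words_def)
qed

text \<open>Reduces to \<open>invs_swap_consecutive\<close>, according to which of the two values
  comes first.\<close>

lemma even_invs_transpose:
  assumes "distinct l" "v \<in> set l" "Suc v \<in> set l"
  shows "even (invs (map (transpose v (Suc v)) l)) \<longleftrightarrow> odd (invs l)"
proof -
  have id: "map (transpose v (Suc v)) l = l" if "v \<notin> set l" "Suc v \<notin> set l" for l
    using that by (intro map_idI) (metis transpose_apply_other)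
  obtain xs ys where l: "l = xs @ v # ys" using assms(2) by (auto dest: split_list)
  then consider "Suc v \<in> set xs" | "Suc v \<in> set ys" using assms(3) by auto
  then show ?thesis
  proof cases
    case 1
    then obtain as bs where "xs = as @ Suc v # bs" by (auto dest: split_list)
    then have l: "l = as @ Suc v # bs @ v # ys" using l by simp
    then have n: "v \<notin> set (as @ bs @ ys)" "Suc v \<notin> set (as @ bs @ ys)" using assms(1) by auto
    then have "map (transpose v (Suc v)) l = as @ v # bs @ Suc v # ys"
      using l id[of as] id[of bs] id[of ys] by simp
    then show ?thesis using invs_swap_consecutive[OF n] l by simp
  next
    case 2
    then obtain as bs where "ys = as @ Suc v # bs" by (auto dest: split_list)
    then have l: "l = xs @ v # as @ Suc v # bs" using l by simp
    then have n: "v \<notin> set (xs @ as @ bs)" "Suc v \<notin> set (xs @ as @ bs)" using assms(1) by auto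
    then have "map (transpose v (Suc v)) l = xs @ Suc v # as @ v # bs"
      using l id[of xs] id[of as] id[of bs] by simp
    then show ?thesis using invs_swap_consecutive[OF n] l by simp
  qed
qed

text \<open>Adjacent letters of different colors are compared by color alone. For equal colors the
  exchange matters only if the two letters have the values \<open>v\<close> and
  \<open>Suc v\<close>, which would be a domino. Hence the descent set is kept.\<close>

lemma majF_swap_values:
  assumes "distinct (map fst \<pi>)" "\<not> has_domino v \<pi>"
  shows "majF (swap_values v \<pi>) = majF \<pi>"
proof -
  have "colored_less (swap_values v \<pi> ! Suc i) (swap_values v \<pi> ! i) \<longleftrightarrow>
      colored_less (\<pi> ! Suc i) (\<pi> ! i)" if i: "Suc i < length \<pi>" for i
  proof -
    have \<pi>: "\<pi> = take i \<pi> @ [\<pi> ! i, \<pi> ! Suc i] @ drop (Suc (Suc i)) \<pi>"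
      using i by (simp add: Cons_nth_drop_Suc Suc_lessD)
    obtain a z b w where ab: "\<pi> ! i = (a, z)" "\<pi> ! Suc i = (b, w)" by (metis surj_pair)
    have "a \<noteq> b" using assms(1) i nth_eq_iff_index_eq[of "map fst \<pi>" i "Suc i"] ab by simp
    have nd: "\<not> (z = w \<and> (a = v \<and> b = Suc v \<or> a = Suc v \<and> b = v))"
      using assms(2) \<pi> ab unfolding has_domino_def by metis
    have "swap_values v \<pi> ! i = (transpose v (Suc v) a, z)"
      "swap_values v \<pi> ! Suc i = (transpose v (Suc v) b, w)"
      using i ab by (simp_all add: swap_values_def)
    then show ?thesis using ab nd \<open>a \<noteq> b\<close>
      by (auto simp: colored_less_def transpose_def)
  qed
  then have "colored_less (swap_values v \<pi> ! i) (swap_values v \<pi> ! (i - 1)) \<longleftrightarrow>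
      colored_less (\<pi> ! i) (\<pi> ! (i - 1))" if "1 \<le> i" "i < length \<pi>" for i
    using that by (cases i) auto
  moreover have "length (swap_values v \<pi>) = length \<pi>" by (simp add: swap_values_def)
  ultimately show ?thesis unfolding majF_conv_sum by (intro sum.cong) auto
qed

lemma minus_one_power_odd_even:
  "(even a \<longleftrightarrow> odd b) \<Longrightarrow> (-1 :: 'a::comm_ring_1) ^ a = - ((-1) ^ b)"
  by (cases "even b") auto

lemma weight_swap_values:
  assumes "v \<in> V" "Suc v \<in> V" "\<pi> \<in> words r C V" "\<not> has_domino v \<pi>"
  shows "weight (-1) X Q (swap_values v \<pi>) = - weight (-1) X Q \<pi>"
proof -
  have d: "distinct (map fst \<pi>)" "set (map fst \<pi>) = V"
    using assms(3) by (simp_all add: words_def)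
  have "map snd (swap_values v \<pi>) = map snd \<pi>"
    by (simp add: swap_values_def case_prod_unfold comp_def)
  then have "col (swap_values v \<pi>) = col \<pi>" by (simp add: col_def)
  moreover have "(-1 :: 'a) ^ invs (map fst (swap_values v \<pi>)) = - ((-1) ^ invs (map fst \<pi>))"
    using even_invs_transpose[OF d(1)] d(2) assms(1,2)
    by (intro minus_one_power_odd_even) (simp only: map_fst_swap_values)
  ultimately show ?thesis
    by (simp add: weight_def majF_swap_values[OF d(1) assms(4)])
qed

text \<open>The letter \<open>y\<close> occurs only once, so both factorizations place it alike;
  then \<open>x\<close> would stand on both sides of it. This separates the two orders of a
  domino.\<close>

lemma append_swap_adjacent_neq:
  assumes "distinct (map fst (us @ [x, y] @ vs))" "us @ [x, y] @ vs = us' @ [y, x] @ vs'"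
  shows False
proof -
  have "y \<notin> set (us @ [x])" "y \<notin> set vs" using assms(1) by auto
  moreover have "(us @ [x]) @ y # vs = us' @ y # x # vs'" using assms(2) by simp
  ultimately have "us' = us @ [x]" by (metis append_Cons_eq_iff)
  then show False using assms by auto
qed

text \<open>The word determines the color and the order of its domino, so the classes are disjoint,
  and each is handled by deleting a block of length 2.\<close>

lemma sum_words_has_domino:
  fixes f :: "colored list \<Rightarrow> 'a::comm_monoid_add"
  assumes "finite V" "v \<in> V" "Suc v \<in> V" "v \<notin> fst ` set C" "Suc v \<notin> fst ` set C"
  shows "sum f {\<pi> \<in> words r C V. has_domino v \<pi>} =
    (\<Sum>z<r. \<Sum>u \<in> words r C (V - {v, Suc v}). \<Sum>p\<le>length u.
       f (take p u @ [(v, z), (Suc v, z)] @ drop p u) + f (take p u @ [(Suc v, z), (v, z)] @ drop p u))"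
proof -
  let ?P = "\<lambda>z. {\<pi> \<in> words r C V. \<exists>us vs. \<pi> = us @ [(v, z), (Suc v, z)] @ vs}"
  let ?N = "\<lambda>z. {\<pi> \<in> words r C V. \<exists>us vs. \<pi> = us @ [(Suc v, z), (v, z)] @ vs}"
  note fin = finite_words[OF assms(1)]
  have "{\<pi> \<in> words r C V. has_domino v \<pi>} \<subseteq> (\<Union>z<r. ?P z \<union> ?N z)"
  proof
    fix \<pi> assume "\<pi> \<in> {\<pi> \<in> words r C V. has_domino v \<pi>}"
    then obtain us z vs where \<pi>: "\<pi> \<in> words r C V"
      and eq: "\<pi> = us @ [(v, z), (Suc v, z)] @ vs \<or> \<pi> = us @ [(Suc v, z), (v, z)] @ vs"
      unfolding has_domino_def by blast
    then have "(v, z) \<in> set \<pi>" by auto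
    then have "z < r" using \<pi> by (auto simp: words_def)
    then show "\<pi> \<in> (\<Union>z<r. ?P z \<union> ?N z)" using \<pi> eq by blast
  qed
  then have eq: "{\<pi> \<in> words r C V. has_domino v \<pi>} = (\<Union>z<r. ?P z \<union> ?N z)"
    unfolding has_domino_def by blast
  have disj: "(?P z \<union> ?N z) \<inter> (?P z' \<union> ?N z') = {}" if "z \<noteq> z'" for z z'
  proof -
    have False if "\<pi> \<in> ?P z \<union> ?N z" "\<pi> \<in> ?P z' \<union> ?N z'" for \<pi>
    proof -
      have "(v, y) \<in> set \<pi>" if "\<pi> \<in> ?P y \<union> ?N y" for y using that by auto
      then have "(v, z) \<in> set \<pi>" "(v, z') \<in> set \<pi>" using that by blast+
      moreover have "distinct (map fst \<pi>)" using that by (auto simp: words_def)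
      ultimately show False using \<open>z \<noteq> z'\<close> by (metis eq_key_imp_eq_value)
    qed
    then show ?thesis by blast
  qed
  have "sum f {\<pi> \<in> words r C V. has_domino v \<pi>} = (\<Sum>z<r. sum f (?P z \<union> ?N z))"
    by (subst eq, rule sum.UNION_disjoint) (use fin disj in auto)
  also have "\<dots> = (\<Sum>z<r. sum f (?P z) + sum f (?N z))"
  proof (intro sum.cong refl sum.union_disjoint)
    fix z
    have False if \<pi>: "\<pi> \<in> ?P z" "\<pi> \<in> ?N z" for \<pi>
    proof -
      obtain us vs us' vs' where eq: "\<pi> = us @ [(v, z), (Suc v, z)] @ vs"
        "\<pi> = us' @ [(Suc v, z), (v, z)] @ vs'" using \<pi> by blast
      have "distinct (map fst \<pi>)" using \<pi> by (simp add: words_def)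
      then show False using append_swap_adjacent_neq[of us "(v, z)" "(Suc v, z)" vs us' vs'] eq
        by metis
    qed
    then show "?P z \<inter> ?N z = {}" by blast
  qed (use fin in auto)
  also have "\<dots> = (\<Sum>z<r. \<Sum>u \<in> words r C (V - {v, Suc v}). \<Sum>p\<le>length u.
       f (take p u @ [(v, z), (Suc v, z)] @ drop p u) + f (take p u @ [(Suc v, z), (v, z)] @ drop p u))"
  proof (intro sum.cong refl)
    fix z assume z: "z \<in> {..<r}"
    have "sum f (?P z) = (\<Sum>u \<in> words r C (V - fst ` set [(v, z), (Suc v, z)]). \<Sum>p\<le>length u.
        f (take p u @ [(v, z), (Suc v, z)] @ drop p u))"
      using assms z by (intro sum_words_containing_block) auto
    moreover have "sum f (?N z) = (\<Sum>u \<in> words r C (V - fst ` set [(Suc v, z), (v, z)]). \<Sum>p\<le>length u.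
        f (take p u @ [(Suc v, z), (v, z)] @ drop p u))"
      using assms z by (intro sum_words_containing_block) auto
    moreover have "fst ` set [(v, z), (Suc v, z)] = {v, Suc v}"
      "fst ` set [(Suc v, z), (v, z)] = {v, Suc v}" by auto
    ultimately show "sum f (?P z) + sum f (?N z) = (\<Sum>u \<in> words r C (V - {v, Suc v}). \<Sum>p\<le>length u.
       f (take p u @ [(v, z), (Suc v, z)] @ drop p u) + f (take p u @ [(Suc v, z), (v, z)] @ drop p u))"
      by (simp only: sum.distrib)
  qed
  finally show ?thesis .
qed

text \<open>\<open>swap_values v\<close> is a sign-reversing involution of these words, so the sum
  equals its own negative and vanishes in characteristic 0.\<close>

lemma sum_weight_no_domino:
  fixes X Q :: "'a::{idom, ring_char_0}"
  assumes "v \<in> V" "Suc v \<in> V" "v \<notin> fst ` set C" "Suc v \<notin> fst ` set C"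
  shows "sum (weight (-1) X Q) {\<pi> \<in> words r C V. \<not> has_domino v \<pi>} = 0"
proof -
  let ?W = "{\<pi> \<in> words r C V. \<not> has_domino v \<pi>}"
  have "sum (weight (-1) X Q) ?W = (\<Sum>\<pi>\<in>?W. - weight (-1) X Q \<pi>)"
    by (rule sum.reindex_bij_witness[of _ "swap_values v" "swap_values v"])
      (use assms in \<open>auto simp: has_domino_swap_values swap_values_words
          weight_swap_values[where V = V and r = r and C = C]\<close>)
  then have "2 * sum (weight (-1) X Q) ?W = 0"
    by (simp add: sum_negf)
  then show ?thesis by simp
qed

section \<open>Inserting a pair of consecutive values when the sign is -1\<close>

lemma sum_weight_insert_pair:
  fixes X Q :: "'a::{idom, ring_char_0}"
  assumes "finite V" "v \<in> V" "Suc v \<in> V" "v \<notin> fst ` set C" "Suc v \<notin> fst ` set C"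
  shows "sum (weight (-1) X Q) (words r C V) =
    sum (weight (-1) X Q) (words r C (V - {v, Suc v})) *
      (qbracket r (X\<^sup>2) * pair_factor Q (card (V - {v, Suc v})))"
proof -
  let ?c = "card (V - {v, Suc v})"
  have ins: "(\<Sum>p\<le>length u. weight (-1) X Q (take p u @ [(v, z), (Suc v, z)] @ drop p u) +
      weight (-1) X Q (take p u @ [(Suc v, z), (v, z)] @ drop p u))
      = weight (-1) X Q u * (X\<^sup>2) ^ z * pair_factor Q ?c" if u: "u \<in> words r C (V - {v, Suc v})" for u z
  proof -
    let ?B = "[(v, z), (Suc v, z)]" and ?B' = "[(Suc v, z), (v, z)]"
    have notin: "fst y \<noteq> v" "fst y \<noteq> Suc v" if "y \<in> set u" for y
      using that u by (auto simp: words_def)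
    \<comment> \<open>The two orders carry opposite signs and their major indices differ by
      \<open>Suc p\<close>, which produces the factor \<open>1 - Q ^ Suc p\<close>.\<close>
    have "weight (-1) X Q (take p u @ ?B @ drop p u) + weight (-1) X Q (take p u @ ?B' @ drop p u)
       = (-1) ^ invs (map fst u) * X ^ col u * (X\<^sup>2) ^ z *
         (Q ^ majF (take p u @ ?B @ drop p u) * (1 - Q ^ Suc p))" if p: "p \<le> length u" for p
    proof -
      let ?us = "map fst (take p u)" and ?vs = "map fst (drop p u)"
      have us_vs: "?us @ ?vs = map fst u" by (simp flip: map_append)
      have n_u: "v \<notin> set (map fst u)" "Suc v \<notin> set (map fst u)"
        using u by (simp_all add: words_def)
      have n: "v \<notin> set (?us @ ?vs)" "Suc v \<notin> set (?us @ ?vs)"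
        unfolding us_vs by (fact n_u)+
      have "even (invs (?us @ v # Suc v # ?vs)) \<longleftrightarrow> even (invs (map fst u))"
        using even_invs_insert_consecutive[OF n] unfolding us_vs .
      then have s1: "(-1 :: 'a) ^ invs (?us @ v # Suc v # ?vs) = (-1) ^ invs (map fst u)"
        by (simp add: minus_one_power_iff)
      have s2: "(-1 :: 'a) ^ invs (?us @ Suc v # v # ?vs) = - ((-1) ^ invs (map fst u))"
        using invs_swap_consecutive[of v ?us "[]" ?vs] n s1 by (simp only: append_Nil power_Suc) simp
      \<comment> \<open>The decreasing order adds a descent at position \<open>Suc p\<close>. The
        comparisons on either side of the pair agree, as no letter of \<open>u\<close> lies between
        \<open>(v, z)\<close> and \<open>(Suc v, z)\<close> in the order.\<close>
      have "majF (take p u @ ?B' @ drop p u) = majF (take p u @ ?B @ drop p u) + Suc p"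
      proof (rule majF_replace_block)
        fix y assume "y \<in> set (drop p u)"
        then have "y \<in> set u" by (rule in_set_dropD)
        from notin[OF this] show "colored_less y (last ?B') \<longleftrightarrow> colored_less y (last ?B)"
          by (auto simp: colored_less_def)
      next
        have "majF ((take p u @ [(Suc v, z)]) @ [(v, z)]) = majF (take p u @ [(Suc v, z)]) + Suc p"
          using p by (simp only: majF_snoc) (simp add: colored_less_def)
        moreover have "majF ((take p u @ [(v, z)]) @ [(Suc v, z)]) = majF (take p u @ [(v, z)])"
          by (simp only: majF_snoc) (simp add: colored_less_def)
        moreover have "majF (take p u @ [(Suc v, z)]) = majF (take p u @ [(v, z)])"
        proof (cases "take p u = []")
          case False
          then have "last (take p u) \<in> set u" by (meson in_set_takeD last_in_set)
          then have "fst (last (take p u)) \<noteq> v" "fst (last (take p u)) \<noteq> Suc v" using notin by blast+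
          then show ?thesis by (auto simp: majF_snoc colored_less_def)
        qed (simp add: majF_snoc)
        ultimately show "majF (take p u @ ?B') = majF (take p u @ ?B) + Suc p" by simp
      qed simp_all
      moreover have "col (take p u @ B @ drop p u) = col B + col u" for B
        using col_append[of "take p u" "drop p u"] by (simp add: col_append)
      \<comment> \<open>Two letters of color \<open>z\<close> contribute \<open>2 * z\<close>, hence
        the base X^2.\<close>
      then have "X ^ col (take p u @ ?B @ drop p u) = (X\<^sup>2) ^ z * X ^ col u"
        "X ^ col (take p u @ ?B' @ drop p u) = (X\<^sup>2) ^ z * X ^ col u"
        by (simp_all only: power_add) (simp_all add: col_def power_mult[symmetric] mult_2)
      ultimately show ?thesis
        using s1 s2 by (simp add: weight_def power_add right_diff_distrib)
    qed
    then have "(\<Sum>p\<le>length u. weight (-1) X Q (take p u @ ?B @ drop p u) + weight (-1) X Q (take p u @ ?B' @ drop p u))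
      = (-1) ^ invs (map fst u) * X ^ col u * (X\<^sup>2) ^ z *
         (\<Sum>p\<le>length u. Q ^ majF (take p u @ ?B @ drop p u) * (1 - Q ^ Suc p))"
      by (simp add: sum_distrib_left)
    also have "(\<Sum>p\<le>length u. Q ^ majF (take p u @ ?B @ drop p u) * (1 - Q ^ Suc p))
      = Q ^ majF u * pair_factor Q (length u)"
    proof (rule sum_insert_block)
      fix y assume "y \<in> set u"
      then show "colored_less (hd ?B) y \<longleftrightarrow> \<not> colored_less y (last ?B)"
        using notin[of y] by (auto simp: colored_less_def)
    next
      fix m show "pair_factor Q (Suc m) = Q ^ length ?B * pair_factor Q m + (1 - Q ^ Suc (Suc m))"
        using pair_factor_Suc'[of Q m] by (simp add: power2_eq_square)
    qed (simp_all add: pair_factor_def colored_less_def)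
    finally show ?thesis
      using length_words[OF u] by (simp add: weight_def mult_ac)
  qed
  define W where "W = sum (weight (-1) X Q) (words r C (V - {v, Suc v}))"
  have "sum (weight (-1) X Q) (words r C V) = sum (weight (-1) X Q) {\<pi> \<in> words r C V. has_domino v \<pi>}
      + sum (weight (-1) X Q) {\<pi> \<in> words r C V. \<not> has_domino v \<pi>}"
    using sum.Int_Diff[OF finite_words[OF assms(1)], of "weight (-1) X Q" r C "Collect (has_domino v)"]
    by (simp add: Int_def set_diff_eq)
  also have "\<dots> = (\<Sum>z<r. \<Sum>u \<in> words r C (V - {v, Suc v}).
      weight (-1) X Q u * (X\<^sup>2) ^ z * pair_factor Q ?c)"
    unfolding sum_weight_no_domino[OF assms(2-5)] sum_words_has_domino[OF assms] add_0_right
    by (rule sum.cong[OF refl], rule sum.cong[OF refl], rule ins)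
  also have "\<dots> = (\<Sum>z<r. W * ((X\<^sup>2) ^ z * pair_factor Q ?c))"
    by (simp add: W_def sum_distrib_right mult.assoc)
  also have "\<dots> = W * (qbracket r (X\<^sup>2) * pair_factor Q ?c)"
    by (simp add: qbracket_def[of r "X\<^sup>2"] sum_distrib_left sum_distrib_right)
  finally show ?thesis by (simp add: W_def)
qed

section \<open>Extending an interval of values by pairs\<close>

lemma sum_weight_add_pair:
  fixes X :: "'a::{idom, ring_char_0}"
  assumes "finite V" "v \<notin> V" "Suc v \<notin> V" "v \<notin> fst ` set C" "Suc v \<notin> fst ` set C" "X\<^sup>2 \<noteq> 1"
  shows "sum (weight (-1) X (X ^ r)) (words r C (insert v (insert (Suc v) V))) =
    sum (weight (-1) X (X ^ r)) (words r C V) *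
      (\<Prod>i = card V + 1..card V + 2. qbracket (i * r) ((-1) ^ (i - 1) * X))"
proof -
  let ?V = "insert v (insert (Suc v) V)"
  have "?V - {v, Suc v} = V" using assms by auto
  then have "sum (weight (-1) X (X ^ r)) (words r C ?V) =
      sum (weight (-1) X (X ^ r)) (words r C V) * (qbracket r (X\<^sup>2) * pair_factor (X ^ r) (card V))"
    using sum_weight_insert_pair[of ?V v C X "X ^ r" r] assms by simp
  also have "qbracket r (X\<^sup>2) * pair_factor (X ^ r) (card V) =
      (\<Prod>i = card V + 1..card V + 2. qbracket (i * r) ((-1) ^ (i - 1) * X))"
    using qbracket_pair_factor[OF assms(6)]
    by (simp add: numeral_2_eq_2 prod.atLeast_Suc_atMost)
  finally show ?thesis .
qed

text \<open>Each further pair supplies the next two factors, indexed by the number of letters then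
  present. The bound \<open>lo \<le> Suc hi\<close> makes \<open>Suc hi - lo\<close> the true size
  of the initial interval, which may be empty.\<close>

lemma sum_weight_extend_above:
  fixes X :: "'a::{idom, ring_char_0}"
  assumes "X\<^sup>2 \<noteq> 1" "fst ` set C \<subseteq> {lo..hi}" "lo \<le> Suc hi"
  shows "sum (weight (-1) X (X ^ r)) (words r C {lo..hi + 2 * j}) =
    sum (weight (-1) X (X ^ r)) (words r C {lo..hi}) *
      (\<Prod>i = (Suc hi - lo) + 1..(Suc hi - lo) + 2 * j. qbracket (i * r) ((-1) ^ (i - 1) * X))"
proof (induction j)
  case (Suc j)
  let ?v = "Suc (hi + 2 * j)" and ?V = "{lo..hi + 2 * j}" and ?m = "Suc hi - lo"
  have "{lo..hi + 2 * Suc j} = insert ?v (insert (Suc ?v) ?V)" using assms(3) by auto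
  moreover have "?v \<notin> fst ` set C" "Suc ?v \<notin> fst ` set C" using assms(2) by force+
  moreover have "card ?V = ?m + 2 * j" using assms(3) by simp
  ultimately show ?case
    using sum_weight_add_pair[of ?V ?v C X r] assms(1) Suc by (simp add: mult_ac)
qed simp

text \<open>The mirror image, with pairs added downwards; \<open>2 * j \<le> lo\<close> keeps the
  subtraction from being truncated.\<close>

lemma sum_weight_extend_below:
  fixes X :: "'a::{idom, ring_char_0}"
  assumes "X\<^sup>2 \<noteq> 1" "fst ` set C \<subseteq> {lo..hi}" "lo \<le> Suc hi" "2 * j \<le> lo"
  shows "sum (weight (-1) X (X ^ r)) (words r C {lo - 2 * j..hi}) =
    sum (weight (-1) X (X ^ r)) (words r C {lo..hi}) *
      (\<Prod>i = (Suc hi - lo) + 1..(Suc hi - lo) + 2 * j. qbracket (i * r) ((-1) ^ (i - 1) * X))"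
  using assms(4)
proof (induction j)
  case (Suc j)
  let ?v = "lo - 2 * Suc j" and ?V = "{lo - 2 * j..hi}" and ?m = "Suc hi - lo"
  have "{?v..hi} = insert ?v (insert (Suc ?v) ?V)" using assms(3) Suc.prems by auto
  moreover have "?v \<notin> fst ` set C" "Suc ?v \<notin> fst ` set C"
    using assms(2) Suc.prems by force+
  moreover have "card ?V = ?m + 2 * j" using assms(3) Suc.prems by simp
  moreover have "?v \<notin> ?V" "Suc ?v \<notin> ?V" using Suc.prems by auto
  ultimately show ?case
    using sum_weight_add_pair[of ?V ?v C X r] assms(1) Suc by (simp add: mult_ac)
qed simp

text \<open>The factor of a pair depends only on the number of letters present, so the products for
  the pairs below and above join into one range.\<close>

lemma sum_weight_extend_pairs:
  fixes X :: "'a::{idom, ring_char_0}"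
  assumes "X\<^sup>2 \<noteq> 1" "fst ` set C \<subseteq> {lo..hi}" "lo \<le> Suc hi" "2 * i \<le> lo"
  shows "sum (weight (-1) X (X ^ r)) (words r C {lo - 2 * i..hi + 2 * j}) =
    sum (weight (-1) X (X ^ r)) (words r C {lo..hi}) *
      (\<Prod>l = (Suc hi - lo) + 1..(Suc hi - lo) + 2 * i + 2 * j. qbracket (l * r) ((-1) ^ (l - 1) * X))"
proof -
  let ?f = "\<lambda>l. qbracket (l * r) ((-1) ^ (l - 1) * X)" and ?m = "Suc hi - lo"
  have "Suc hi - (lo - 2 * i) = ?m + 2 * i" using assms(3,4) by simp
  moreover have "fst ` set C \<subseteq> {lo - 2 * i..hi}" using assms(2) by force
  ultimately have "sum (weight (-1) X (X ^ r)) (words r C {lo - 2 * i..hi + 2 * j}) =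
      sum (weight (-1) X (X ^ r)) (words r C {lo..hi}) *
      (prod ?f {?m + 1..?m + 2 * i} * prod ?f {?m + 2 * i + 1..?m + 2 * i + 2 * j})"
    using sum_weight_extend_above[OF assms(1), of C "lo - 2 * i" hi r j]
      sum_weight_extend_below[OF assms] assms(3) by (simp add: mult.assoc)
  also have "prod ?f {?m + 1..?m + 2 * i} * prod ?f {?m + 2 * i + 1..?m + 2 * i + 2 * j}
    = prod ?f {?m + 1..?m + 2 * i + 2 * j}"
    using prod.ub_add_nat[of "?m + 1" "?m + 2 * i" ?f "2 * j"] by simp
  finally show ?thesis .
qed

text \<open>Without signs the letters can be added singly and in any order, since each factor
  depends only on the number of letters.\<close>

lemma sum_weight_insert_letters:
  fixes X Q :: "'a::comm_ring_1"
  assumes "finite V" "fst ` set C \<subseteq> V"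
  shows "sum (weight 1 X Q) (words r C V) =
    sum (weight 1 X Q) (words r C (fst ` set C)) *
      (\<Prod>i = card (fst ` set C) + 1..card V. qbracket r X * qbracket i Q)"
proof -
  have "sum (weight 1 X Q) (words r C (fst ` set C \<union> F)) =
    sum (weight 1 X Q) (words r C (fst ` set C)) *
      (\<Prod>i = card (fst ` set C) + 1..card (fst ` set C) + card F. qbracket r X * qbracket i Q)"
    if "finite F" "F \<inter> fst ` set C = {}" for F
    using that
  proof (induction F rule: finite_induct)
    case (insert v F)
    let ?V = "fst ` set C \<union> insert v F"
    have "?V - {v} = fst ` set C \<union> F" using insert by auto
    moreover have "card ?V = Suc (card (fst ` set C) + card F)"
      using insert by (subst card_Un_disjoint) auto
    ultimately show ?case
      using sum_weight_insert_letter[of ?V v C X Q r] insert by (simp add: mult_ac)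
  qed simp
  moreover have "(V - fst ` set C) \<inter> fst ` set C = {}" by blast
  ultimately have "sum (weight 1 X Q) (words r C (fst ` set C \<union> (V - fst ` set C))) =
    sum (weight 1 X Q) (words r C (fst ` set C)) * (\<Prod>i = card (fst ` set C) + 1..
      card (fst ` set C) + card (V - fst ` set C). qbracket r X * qbracket i Q)"
    using assms(1) by blast
  then show ?thesis
    using assms by (simp add: Un_absorb1 card_Diff_subset card_mono)
qed

subsection \<open>Colored permutations containing a run\<close>

definition run :: "nat \<Rightarrow> nat \<Rightarrow> colored list" where
  "run k b = map (\<lambda>v. (v, 0)) [b - k + 1..<Suc b]"

lemma run_simps:
  assumes "k \<le> b"
  shows "length (run k b) = k" "map fst (run k b) = [Suc (b - k)..<Suc b]"
    "fst ` set (run k b) = {b - k + 1..b}" "col (run k b) = 0"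
    "sorted_wrt colored_less (run k b)"
proof -
  show "length (run k b) = k" "map fst (run k b) = [Suc (b - k)..<Suc b]"
    "col (run k b) = 0"
    using assms by (simp_all add: run_def comp_def col_def del: upt_Suc)
  show "fst ` set (run k b) = {b - k + 1..b}"
    using assms by (auto simp add: run_def image_image simp del: upt_Suc)
  show "sorted_wrt colored_less (run k b)"
    using sorted_wrt_upt[of "b - k + 1" "Suc b"]
    by (simp add: run_def sorted_wrt_map colored_less_def del: upt_Suc)
qed

text \<open>Filtering keeps \<open>C\<close> a subsequence. Since values are distinct and all those
  of \<open>C\<close> occur in the word, both lists have the same length and must coincide.\<close>

lemma subseq_iff_filter_eq:
  assumes "distinct (map fst \<pi>)" "distinct (map fst C)" "fst ` set C \<subseteq> fst ` set \<pi>"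
  shows "subseq C \<pi> \<longleftrightarrow> filter (\<lambda>x. fst x \<in> fst ` set C) \<pi> = C"
proof
  assume "subseq C \<pi>"
  then have "subseq (filter (\<lambda>x. fst x \<in> fst ` set C) C) (filter (\<lambda>x. fst x \<in> fst ` set C) \<pi>)"
    by (rule subseq_filter)
  moreover have "filter (\<lambda>x. fst x \<in> fst ` set C) C = C" by (simp add: filter_id_conv)
  moreover have "length (filter (\<lambda>x. fst x \<in> fst ` set C) \<pi>) = length C"
  proof -
    have "distinct (map fst (filter (\<lambda>x. fst x \<in> fst ` set C) \<pi>))"
      using assms(1) by (rule distinct_map_filter)
    then have "length (filter (\<lambda>x. fst x \<in> fst ` set C) \<pi>)
       = card (fst ` set (filter (\<lambda>x. fst x \<in> fst ` set C) \<pi>))"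
      by (metis distinct_card length_map list.set_map)
    also have "fst ` set (filter (\<lambda>x. fst x \<in> fst ` set C) \<pi>) = fst ` set C"
      using assms(3) by force
    also have "card (fst ` set C) = length C"
      using assms(2) by (metis distinct_card length_map list.set_map)
    finally show ?thesis .
  qed
  ultimately show "filter (\<lambda>x. fst x \<in> fst ` set C) \<pi> = C"
    by (metis subseq_same_length)
next
  assume "filter (\<lambda>x. fst x \<in> fst ` set C) \<pi> = C"
  then show "subseq C \<pi>" by (metis subseq_filter_left)
qed

lemma colored_perms_containing_eq_words:
  assumes "k \<le> b" "b \<le> n"
  shows "colored_perms_containing r n (b - k + 1) b = words r (run k b) {1..n}"
proof -
  have C: "distinct (map fst (run k b))" "fst ` set (run k b) \<subseteq> {1..n}"
    using assms by (simp_all add: run_simps del: upt_Suc)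
  have "subseq (run k b) \<pi> \<longleftrightarrow> filter (\<lambda>x. fst x \<in> fst ` set (run k b)) \<pi> = run k b"
    if "distinct (map fst \<pi>)" "fst ` set \<pi> = {1..n}" for \<pi>
    using that C by (intro subseq_iff_filter_eq) simp_all
  then show ?thesis
    unfolding colored_perms_containing_def colored_perms_def words_def permutations_of_set_def
    by (fold run_def) (auto simp del: upt_Suc)
qed

section \<open>The summand of the theorem as a weight, and the initial sums\<close>

lemma const_poly_power: "[:c:] ^ j = [:c ^ j:]" for c :: "'a::comm_semiring_1"
  by (induction j) (simp_all add: one_pCons mult.commute)

text \<open>The term \<open>r * majF \<pi>\<close> of the flag major index goes to the base
  \<open>q ^ r\<close>; the term \<open>col \<pi>\<close> merges with the power of
  \<open>\<zeta>\<close>.\<close>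

lemma smult_char1_eq_weight:
  "smult (char1 \<zeta> \<epsilon> h \<pi>) (q ^ fmaj r \<pi>) = weight [:\<epsilon>:] (smult (\<zeta> ^ h) q) (q ^ r) \<pi>"
  by (simp add: const_poly_power weight_def char1_def inv_count_eq_invs fmaj_def power_add power_mult smult_power mult_ac)

lemma sum_weight_run:
  assumes "k \<le> b" "r \<ge> 1"
  shows "sum (weight e X Q) (words r (run k b) {b - k + 1..b}) = 1"
proof -
  have "words r (run k b) (fst ` set (run k b)) = {run k b}"
    using assms by (intro words_self) (auto simp add: run_simps, auto simp: run_def)
  moreover have "majF (run k b) = 0"
    using run_simps(5)[OF assms(1)] by (rule majF_sorted)
  moreover have "invs (map fst (run k b)) = 0"
    using assms(1) by (simp add: run_simps invs_sorted del: upt_Suc)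
  ultimately show ?thesis
    using assms by (simp add: run_simps weight_def)
qed

text \<open>In any color, \<open>b - k\<close> lies below all letters of the run, which have color
  0. Placed after \<open>p\<close> of them it creates \<open>p\<close> inversions and a descent at
  \<open>p\<close> (none if \<open>p = 0\<close>), so sign and major index combine to
  \<open>(e * Q) ^ p\<close>.\<close>

lemma sum_weight_run_and_smaller:
  fixes X Q :: "'a::comm_ring_1"
  assumes "k < b" "r \<ge> 1"
  shows "sum (weight e X Q) (words r (run k b) {b - k..b}) = qbracket r X * qbracket (k + 1) (e * Q)"
proof -
  let ?C = "run k b" and ?w = "b - k"
  note C = run_simps[OF less_imp_le[OF assms(1)]]
  have wC: "?w < fst x" "snd x = 0" if "x \<in> set ?C" for x
    using that assms by (auto simp: run_def simp del: upt_Suc)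
  have "words r ?C ({?w..b} - {?w}) = {?C}"
  proof -
    have "{?w..b} - {?w} = fst ` set ?C" using C(3) by auto
    moreover have "distinct (map fst ?C)" by (simp add: C del: upt_Suc)
    ultimately show ?thesis
      using wC(2) assms(2) words_self[of ?C r] by fastforce
  qed
  moreover have weight: "weight e X Q (take p ?C @ (?w, z) # drop p ?C) = X ^ z * (e * Q) ^ p"
    if p: "p \<le> k" for p z
  proof -
    have "invs (take p (map fst ?C) @ ?w # drop p (map fst ?C)) = p"
      using p by (intro invs_insert_min) (use assms(1) in \<open>auto simp: C simp del: upt_Suc\<close>)
    then have "invs (map fst (take p ?C @ (?w, z) # drop p ?C)) = p"
      by (simp add: take_map drop_map)
    moreover have "col (take p ?C @ (?w, z) # drop p ?C) = z + col ?C"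
      using col_append[of "take p ?C" "drop p ?C"] by (simp add: col_def)
    then have "col (take p ?C @ (?w, z) # drop p ?C) = z" by (simp only: C(4) add_0_right)
    moreover have "majF (take p ?C @ (?w, z) # drop p ?C) = p"
    proof -
      have less: "colored_less (?w, z) x" if "x \<in> set ?C" for x
        using wC[OF that] by (auto simp: colored_less_def)
      have s: "sorted_wrt colored_less ((?w, z) # drop p ?C)"
        using less C(5) by (auto simp: sorted_wrt_drop dest: in_set_dropD)
      have t: "majF (take p ?C) = 0"
        using C(5) by (intro majF_sorted sorted_wrt_take)
      have "take p ?C \<noteq> [] \<Longrightarrow> colored_less (?w, z) (last (take p ?C))"
        using less by (meson in_set_takeD last_in_set)
      then show ?thesis
        using majF_append_sorted[OF s, of "take p ?C"] t p C(1)
        by (cases "take p ?C = []") auto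
    qed
    ultimately show ?thesis by (simp add: weight_def power_mult_distrib mult_ac)
  qed
  moreover have "?w \<notin> fst ` set ?C" unfolding C(3) using assms(1) by simp
  then have "sum (weight e X Q) (words r ?C {?w..b}) = (\<Sum>z<r. \<Sum>u \<in> words r ?C ({?w..b} - {?w}).
      \<Sum>p\<le>length u. weight e X Q (take p u @ (?w, z) # drop p u))"
    by (intro sum_words_insert_letter) simp_all
  ultimately have "sum (weight e X Q) (words r ?C {?w..b}) = (\<Sum>z<r. \<Sum>p\<le>k. X ^ z * (e * Q) ^ p)"
    by (simp add: C(1))
  then show ?thesis
    by (simp add: qbracket_def sum_product lessThan_Suc_atMost del: sum.lessThan_Suc)
qed

theorem theorem2p2:
  fixes r n h k b :: nat and \<epsilon> \<zeta> :: complex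
  assumes "r \<ge> 1" and "n \<ge> 1"
    and "primitive_root_of_unity r \<zeta>"
    and "\<epsilon> \<in> {1, -1}" and "h < r"
    and "1 \<le> k" and "k \<le> n - 1"
    and "k \<le> b" and "b \<le> n" and "[b = n] (mod 2)"
  shows "([n - k = 0] (mod 2) \<longrightarrow>
           (\<Sum>\<pi> \<in> colored_perms_containing r n (b - k + 1) b. smult (char1 \<zeta> \<epsilon> h \<pi>) (q ^ fmaj r \<pi>))
           = (\<Prod>i = k+1..n. qbracket (i * r) (smult (\<epsilon> ^ (i - 1) * \<zeta> ^ h) q)))
       \<and> ([n - k = 1] (mod 2) \<longrightarrow>
           (\<Sum>\<pi> \<in> colored_perms_containing r n (b - k + 1) b. smult (char1 \<zeta> \<epsilon> h \<pi>) (q ^ fmaj r \<pi>))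
           = qbracket (k + 1) (smult \<epsilon> (q ^ r)) * qbracket r (smult (\<zeta> ^ h) q)
             * (\<Prod>i = k+2..n. qbracket (i * r) (smult (\<epsilon> ^ (i - 1) * \<zeta> ^ h) q)))"
proof -
  let ?e = "[:\<epsilon>:]"
  define X where "X = smult (\<zeta> ^ h) q"
  have root: "\<zeta> ^ r = 1" using assms(3) by (simp add: primitive_root_of_unity_def)
  \<comment> \<open>\<open>\<zeta> ^ h\<close> is itself an \<open>r\<close>-th root of unity, so
    powers of \<open>X\<close> can also record the major index.\<close>
  have "(\<zeta> ^ h) ^ r = (\<zeta> ^ r) ^ h" by (simp add: power_mult[symmetric] mult.commute)
  then have X_r: "q ^ r = X ^ r" by (simp add: X_def smult_power root)
  have twist: "smult (\<epsilon> ^ j * \<zeta> ^ h) q = ?e ^ j * X" for j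
    by (simp add: X_def const_poly_power mult.commute)
  have twist_r: "smult \<epsilon> (q ^ r) = ?e * X ^ r" unfolding X_r by simp
  have fst_run: "fst ` set (run k b) = {b - k + 1..b}" using assms(8) by (rule run_simps)
  define S where "S = sum (weight ?e X (X ^ r)) (words r (run k b) {1..n})"
  have S: "(\<Sum>\<pi> \<in> colored_perms_containing r n (b - k + 1) b. smult (char1 \<zeta> \<epsilon> h \<pi>) (q ^ fmaj r \<pi>)) = S"
    unfolding smult_char1_eq_weight X_def[symmetric] X_r S_def
      colored_perms_containing_eq_words[OF assms(8,9)] ..
  have main: "(even (n - k) \<longrightarrow> S = (\<Prod>i = k+1..n. qbracket (i * r) (?e ^ (i - 1) * X)))
     \<and> (odd (n - k) \<longrightarrow> S = qbracket (k + 1) (?e * X ^ r) * qbracket r X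
             * (\<Prod>i = k+2..n. qbracket (i * r) (?e ^ (i - 1) * X)))"
  proof (cases "\<epsilon> = 1")
    case True
    then have e: "?e = 1" by (simp add: one_pCons)
    have "S = (\<Prod>i = k + 1..n. qbracket r X * qbracket i (X ^ r))"
      using sum_weight_insert_letters[of "{1..n}" "run k b" X "X ^ r" r] assms(1,8,9) sum_weight_run[OF assms(8,1), of 1 X "X ^ r"]
      unfolding S_def e fst_run by simp
    then have S1: "S = (\<Prod>i = k + 1..n. qbracket (i * r) X)"
      by (simp only: qbracket_mult_power)
    \<comment> \<open>For \<open>\<epsilon> = 1\<close> the second formula is the first with the
      factor for \<open>i = k + 1\<close> split by \<open>qbracket_mult_power\<close>.\<close>
    also have "\<dots> = qbracket ((k + 1) * r) X * (\<Prod>i = k+2..n. qbracket (i * r) X)"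
      using assms(2,7) by (subst prod.atLeast_Suc_atMost) simp_all
    also have "qbracket ((k + 1) * r) X = qbracket (k + 1) (X ^ r) * qbracket r X"
      using qbracket_mult_power[where m = "k + 1" and r = r and X = X] by (metis mult.commute)
    finally show ?thesis using S1 by (simp add: e)
  next
    case False
    then have e: "?e = -1" using assms(4) by (simp add: one_pCons)
    \<comment> \<open>To cancel 1 - X^2 later: the coefficient of X^2 in degree 2 is a power of
      \<open>\<zeta>\<close>, hence nonzero.\<close>
    have "\<zeta> \<noteq> 0" using root assms(1) by (auto simp: power_0_left)
    then have "coeff (X\<^sup>2) 2 \<noteq> coeff 1 2"
      by (simp add: X_def smult_power monom_power power2_eq_square mult_monom)
    then have X2: "X\<^sup>2 \<noteq> 1" by metis
    \<comment> \<open>The number of values above \<open>b\<close> is even, so they are exhausted by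
      \<open>j\<close> pairs.\<close>
    have "even (n - b)" using assms(9,10) by (metis cong_altdef_nat cong_sym)
    then obtain j where j: "n = b + 2 * j" using assms(9) by (metis dvd_def le_add_diff_inverse)
    show ?thesis
    proof (cases "even (n - k)")
      case True
      \<comment> \<open>The values below the run are exhausted by \<open>i\<close> pairs too, so the
        extension starts from the run itself.\<close>
      then have "even (b - k)" using j assms(8) by simp
      then obtain i where i: "b = k + 2 * i" using assms(8) by (metis dvd_def le_add_diff_inverse)
      have "S = (\<Prod>l = k + 1..n. qbracket (l * r) ((-1) ^ (l - 1) * X))"
        using sum_weight_extend_pairs[OF X2 equalityD1[OF fst_run], of i r j]
          sum_weight_run[OF assms(8,1), of "-1" X "X ^ r"]
        unfolding S_def e fst_run j i by simp
      then show ?thesis using True by (simp add: e)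
    next
      case False
      then have "odd (b - k)" using j assms(8) by simp
      then obtain i where "b - k = 2 * i + 1" by (elim oddE)
      then have i: "b = k + 2 * i + 1" using assms(8) by simp
      \<comment> \<open>Pairing leaves one value below the run. Starting from
        \<open>{b - k..b}\<close>, which has \<open>k + 1\<close> values, the \<open>2 * i\<close>
        smaller ones form pairs and the product begins at \<open>k + 2\<close>.\<close>
      have sub: "fst ` set (run k b) \<subseteq> {b - k..b}" unfolding fst_run by auto
      have "S = qbracket r X * qbracket (k + 1) (- 1 * X ^ r) *
          (\<Prod>l = k + 2..n. qbracket (l * r) ((-1) ^ (l - 1) * X))"
        using sum_weight_extend_pairs[OF X2 sub, of i r j]
          sum_weight_run_and_smaller[of k b r "-1" X "X ^ r"] assms(1)
        unfolding S_def e fst_run j i by simp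
      then show ?thesis using False by (simp add: e mult_ac)
    qed
  qed
  show ?thesis
    using main unfolding S twist twist_r X_def[symmetric]
    by (simp add: cong_def even_iff_mod_2_eq_zero odd_iff_mod_2_eq_one)
qed

end
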